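(* Let $n\ge1$ and let $\mathscr{B}=\{B(\alpha,i):\alpha\in\omega_1,\,i\in n\}$ be a transverse family in $\omega_1\times n$ such that for all $\beta<\alpha<\omega_1$ there is $\gamma<\beta$ such that, if $\langle\beta,j\rangle\in B(\alpha,i)$, then $B(\alpha,i)\cap\pi^{-1}((\gamma,\beta])=B(\beta,j)\cap\pi^{-1}((\gamma,\beta])$. Then for any club $E\subset K(\mathscr{B})$ there are $m\le n$ and a club $C\subset\omega_1$ such that $|E\cap(\{\alpha\}\times n)|=m$ for each $\alpha\in C$.
   Context: Identify $n$ with $\{0,\dots,n-1\}$ and let $\pi:\omega_1\times n\to\omega_1$ be the projection; intervals are in $\omega_1$. A family in $\omega_1\times n$ is a collection $\mathscr{B}=\{B(\alpha,i):\alpha\in\omega_1,i\in n\}$ with $B(\alpha,i)\subset[0,\alpha]\times n$, $\langle\alpha,i\rangle\in B(\alpha,i)$, and such that for each $\alpha$ the sets $B(\alpha,0),\dots,B(\alpha,n-1)$ partition $[0,\alpha]\times n$. It is transverse if $B(\alpha,i)\cap\pi^{-1}(\{\beta\})$ is a singleton for each $\beta\le\alpha$ and each $i$. $K(\mathscr{B})$ is $\omega_1\times n$ with the topology in which the sets $B(\alpha,i)\cap\pi^{-1}((\beta,\alpha])$, $\beta<\alpha$, form a neighborhood basis at $\langle\alpha,i\rangle$. For the ordinal $0$, "$\gamma<0$" is understood as allowing $\gamma=-1$, so that $(\gamma,0]=\{0\}$. A subset $E\subset K(\mathscr{B})$ is club if it is closed and $\pi(E)$ is unbounded in $\omega_1$.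 *)

theory Defs
  imports "HOL-Analysis.Analysis" "HOL-Library.Countable_Set_Type"
begin

section \<open>The ordinal \<open>\<omega>\<^sub>1\<close> with its order topology\<close>

text \<open>
  The carrier and the order of \<open>\<omega>\<^sub>1\<close> are those of the cardinal successor of \<open>natLeq\<close>.
  The lemmas \<open>omega1_uncountable\<close> and \<open>omega1_countable_atMost\<close> below, together with the
  \<open>wellorder\<close> instance, characterise this order up to isomorphism.
\<close>

typedef omega1 = "Field (cardSuc natLeq)"
  using Field_cardSuc_not_empty[OF natLeq_Card_order] by blast

instantiation omega1 :: linorder
begin

definition less_eq_omega1 :: "omega1 \<Rightarrow> omega1 \<Rightarrow> bool" where
  "(x :: omega1) \<le> y \<longleftrightarrow> (Rep_omega1 x, Rep_omega1 y) \<in> cardSuc natLeq"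

definition less_omega1 :: "omega1 \<Rightarrow> omega1 \<Rightarrow> bool" where
  "(x :: omega1) < y \<longleftrightarrow> x \<le> y \<and> x \<noteq> y"

instance
proof -
  have wo: "Well_order (cardSuc natLeq)"
    using cardSuc_Card_order[OF natLeq_Card_order] card_order_on_well_order_on by blast
  note d = wo[unfolded well_order_on_def linear_order_on_def partial_order_on_def preorder_on_def]
  have tr: "trans (cardSuc natLeq)" and as: "antisym (cardSuc natLeq)"
    and rf: "refl_on (Field (cardSuc natLeq)) (cardSuc natLeq)"
    and tot: "total_on (Field (cardSuc natLeq)) (cardSuc natLeq)"
    using d by auto
  have anti: "x = y" if "x \<le> y" "y \<le> x" for x y :: omega1
    using antisymD[OF as] that by (simp add: less_eq_omega1_def flip: Rep_omega1_inject)
  have refl: "x \<le> x" for x :: omega1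
    using rf Rep_omega1[of x] by (auto simp: less_eq_omega1_def refl_on_def)
  show "OFCLASS(omega1, linorder_class)"
  proof
    fix x y z :: omega1
    show "x < y \<longleftrightarrow> x \<le> y \<and> \<not> y \<le> x"
      using anti refl by (auto simp: less_omega1_def)
    show "x \<le> x" by (rule refl)
    show "x \<le> y \<Longrightarrow> y \<le> z \<Longrightarrow> x \<le> z"
      using tr by (auto simp: less_eq_omega1_def elim: transE)
    show "x \<le> y \<Longrightarrow> y \<le> x \<Longrightarrow> x = y" by (rule anti)
    show "x \<le> y \<or> y \<le> x"
    proof (cases "x = y")
      case True
      then show ?thesis using refl by simp
    next
      case False
      then show ?thesis
        using tot Rep_omega1[of x] Rep_omega1[of y]
        by (auto simp: less_eq_omega1_def total_on_def Rep_omega1_inject)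
    qed
  qed
qed

end

instance omega1 :: wellorder
proof
  fix P :: "omega1 \<Rightarrow> bool" and a
  assume step: "\<And>x. (\<And>y. y < x \<Longrightarrow> P y) \<Longrightarrow> P x"
  have wf: "wf (cardSuc natLeq - Id)"
    using cardSuc_Card_order[OF natLeq_Card_order] card_order_on_well_order_on
    unfolding well_order_on_def by blast
  have "{(x, y). x < y} \<subseteq> inv_image (cardSuc natLeq - Id) Rep_omega1"
    by (auto simp: less_omega1_def less_eq_omega1_def inv_image_def Rep_omega1_inject)
  then have "wf {(x, y :: omega1). x < y}"
    using wf wf_inv_image wf_subset by blast
  then show "P a"
    by (induction a rule: wf_induct_rule) (use step in blast)
qed

instantiation omega1 :: linorder_topology
begin

definition open_omega1 :: "omega1 set \<Rightarrow> bool" where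
  "open_omega1 = generate_topology (range (\<lambda>a. {..<a}) \<union> range (\<lambda>a. {a<..}))"

instance
  by standard (rule open_omega1_def)

end

instantiation omega1 :: zero
begin

definition zero_omega1 :: omega1 where
  "0 = (LEAST x :: omega1. True)"

instance ..

end

lemma zero_le_omega1 [simp]: "0 \<le> (x :: omega1)"
  unfolding zero_omega1_def by (rule Least_le) simp

lemma omega1_uncountable:
  includes cardinal_syntax
  shows "uncountable (UNIV :: omega1 set)"
proof
  assume "countable (UNIV :: omega1 set)"
  then have "countable (Rep_omega1 ` UNIV)" by (rule countable_image)
  then have "countable (Field (cardSuc natLeq))"
    by (simp add: type_definition.Rep_range[OF type_definition_omega1])
  then have "|Field (cardSuc natLeq)| \<le>o natLeq"
    by (simp add: countable_card_le_natLeq)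
  then have "cardSuc natLeq \<le>o natLeq"
    using card_of_Field_ordIso[OF cardSuc_Card_order[OF natLeq_Card_order]]
      ordIso_ordLeq_trans ordIso_symmetric by blast
  then show False
    using cardSuc_greater[OF natLeq_Card_order] not_ordLess_ordLeq by blast
qed

lemma omega1_countable_atMost:
  includes cardinal_syntax
  shows "countable {..x :: omega1}"
proof -
  let ?r = "cardSuc natLeq"
  have co: "Card_order ?r" by (rule cardSuc_Card_order[OF natLeq_Card_order])
  have "|underS ?r (Rep_omega1 x)| <o ?r"
    using card_of_underS[OF co Rep_omega1] .
  then have "|underS ?r (Rep_omega1 x)| \<le>o natLeq"
    by (rule iffD1[OF cardSuc_ordLeq_ordLess[OF natLeq_Card_order card_of_Card_order]])
  then have "countable (underS ?r (Rep_omega1 x))"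
    by (simp add: countable_card_le_natLeq)
  moreover have "Rep_omega1 ` {..<x} \<subseteq> underS ?r (Rep_omega1 x)"
    by (auto simp: less_omega1_def less_eq_omega1_def underS_def Rep_omega1_inject)
  ultimately have "countable (Rep_omega1 ` {..<x})"
    using countable_subset by blast
  then have "countable {..<x}"
    by (rule countable_image_inj_on) (auto simp: inj_on_def Rep_omega1_inject)
  then have "countable (insert x {..<x})" by simp
  moreover have "{..x} = insert x {..<x}" by auto
  ultimately show ?thesis by simp
qed

definition club_omega1 :: "omega1 set \<Rightarrow> bool" where
  "club_omega1 C \<longleftrightarrow> closed C \<and> \<not> bdd_above C"


section \<open>Families in \<open>\<omega>\<^sub>1 \<times> n\<close>\<close>

text \<open>
  A family \<open>\<B>\<close> is a function \<open>B\<close> whose values \<open>B \<alpha> i\<close> are only relevant for \<open>i < n\<close>;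
  the projection \<open>\<pi>\<close> is \<open>fst\<close>.
\<close>

definition is_family :: "nat \<Rightarrow> (omega1 \<Rightarrow> nat \<Rightarrow> (omega1 \<times> nat) set) \<Rightarrow> bool" where
  "is_family n B \<longleftrightarrow>
     (\<forall>\<alpha>. (\<forall>i<n. B \<alpha> i \<subseteq> {..\<alpha>} \<times> {..<n} \<and> (\<alpha>, i) \<in> B \<alpha> i)
        \<and> disjoint_family_on (B \<alpha>) {..<n}
        \<and> (\<Union>i<n. B \<alpha> i) = {..\<alpha>} \<times> {..<n})"

definition transverse :: "nat \<Rightarrow> (omega1 \<Rightarrow> nat \<Rightarrow> (omega1 \<times> nat) set) \<Rightarrow> bool" where
  "transverse n B \<longleftrightarrow>
     (\<forall>\<alpha>. \<forall>i<n. \<forall>\<beta>\<le>\<alpha>. is_singleton (B \<alpha> i \<inter> fst -` {\<beta>}))"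

text \<open>
  The intervals \<open>(\<gamma>, \<beta>]\<close> with \<open>\<gamma> < \<beta>\<close>. For \<open>\<beta> = 0\<close> the only admissible \<open>\<gamma>\<close> is \<open>-1\<close>,
  which is not an element of the type and yields the interval \<open>{0}\<close>.
\<close>

definition left_intervals :: "omega1 \<Rightarrow> omega1 set set" where
  "left_intervals \<beta> = (if \<beta> = 0 then {{0}} else {{\<gamma><..\<beta>} | \<gamma>. \<gamma> < \<beta>})"

definition coherent :: "nat \<Rightarrow> (omega1 \<Rightarrow> nat \<Rightarrow> (omega1 \<times> nat) set) \<Rightarrow> bool" where
  "coherent n B \<longleftrightarrow>
     (\<forall>\<alpha>. \<forall>\<beta><\<alpha>. \<exists>I\<in>left_intervals \<beta>. \<forall>i<n. \<forall>j<n.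
        (\<beta>, j) \<in> B \<alpha> i \<longrightarrow> B \<alpha> i \<inter> fst -` I = B \<beta> j \<inter> fst -` I)"

text \<open>
  A set is open in \<open>K(\<B>)\<close> iff it contains a basic set at each of its points. This is the only
  topology for which the basic sets can form neighbourhood bases; for coherent families they
  do, and they are moreover open (lemmas \<open>openin_K_basic\<close> and \<open>openin_K\<close>).
\<close>

definition K :: "nat \<Rightarrow> (omega1 \<Rightarrow> nat \<Rightarrow> (omega1 \<times> nat) set) \<Rightarrow> (omega1 \<times> nat) topology" where
  "K n B = topology (\<lambda>U. U \<subseteq> UNIV \<times> {..<n} \<and>
     (\<forall>(\<alpha>, i)\<in>U. \<exists>I\<in>left_intervals \<alpha>. B \<alpha> i \<inter> fst -` I \<subseteq> U))"

definition club_K :: "nat \<Rightarrow> (omega1 \<Rightarrow> nat \<Rightarrow> (omega1 \<times> nat) set) \<Rightarrow> (omega1 \<times> nat) set \<Rightarrow> bool" where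
  "club_K n B E \<longleftrightarrow> closedin (K n B) E \<and> \<not> bdd_above (fst ` E)"

lemma left_intervals_Int:
  assumes "I \<in> left_intervals \<beta>" "J \<in> left_intervals \<beta>"
  shows "I \<inter> J \<in> left_intervals \<beta>"
proof (cases "\<beta> = 0")
  case False
  then obtain c d where "I = {c<..\<beta>}" "J = {d<..\<beta>}" "c < \<beta>" "d < \<beta>"
    using assms by (auto simp: left_intervals_def)
  then have "I \<inter> J = {max c d<..\<beta>}" "max c d < \<beta>" by auto
  then show ?thesis using False by (auto simp: left_intervals_def)
qed (use assms in \<open>auto simp: left_intervals_def\<close>)

lemma left_intervals_nonempty: "\<exists>I. I \<in> left_intervals \<beta>"
proof (cases "\<beta> = 0")
  case False
  then have "0 < \<beta>" by (simp add: order_less_le)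
  then show ?thesis using False by (auto simp: left_intervals_def)
qed (auto simp: left_intervals_def)

lemma openin_K:
  "openin (K n B) U \<longleftrightarrow> U \<subseteq> UNIV \<times> {..<n} \<and>
     (\<forall>(\<alpha>, i)\<in>U. \<exists>I\<in>left_intervals \<alpha>. B \<alpha> i \<inter> fst -` I \<subseteq> U)"
proof -
  have "istopology (\<lambda>U. U \<subseteq> UNIV \<times> {..<n} \<and>
     (\<forall>(\<alpha>, i)\<in>U. \<exists>I\<in>left_intervals \<alpha>. B \<alpha> i \<inter> fst -` I \<subseteq> U))" (is "istopology ?P")
    unfolding istopology_def
  proof (intro conjI allI impI)
    fix S T assume S: "?P S" and T: "?P T"
    show "S \<inter> T \<subseteq> UNIV \<times> {..<n}" using S by blast
    show "\<forall>(\<alpha>, i)\<in>S \<inter> T. \<exists>I\<in>left_intervals \<alpha>. B \<alpha> i \<inter> fst -` I \<subseteq> S \<inter> T"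
    proof clarify
      fix \<alpha> i assume "(\<alpha>, i) \<in> S" "(\<alpha>, i) \<in> T"
      then obtain I J where "I \<in> left_intervals \<alpha>" "J \<in> left_intervals \<alpha>"
        "B \<alpha> i \<inter> fst -` I \<subseteq> S" "B \<alpha> i \<inter> fst -` J \<subseteq> T"
        using S T by blast
      then show "\<exists>I\<in>left_intervals \<alpha>. B \<alpha> i \<inter> fst -` I \<subseteq> S \<inter> T"
        by (intro bexI[of _ "I \<inter> J"] left_intervals_Int) auto
    qed
  next
    fix \<K> assume *: "\<forall>S\<in>\<K>. ?P S"
    then show "\<Union>\<K> \<subseteq> UNIV \<times> {..<n}" by blast
    show "\<forall>(\<alpha>, i)\<in>\<Union>\<K>. \<exists>I\<in>left_intervals \<alpha>. B \<alpha> i \<inter> fst -` I \<subseteq> \<Union>\<K>"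
    proof clarify
      fix \<alpha> i S assume "(\<alpha>, i) \<in> S" "S \<in> \<K>"
      have "?P S" using * \<open>S \<in> \<K>\<close> by (rule bspec)
      then obtain I where "I \<in> left_intervals \<alpha>" "B \<alpha> i \<inter> fst -` I \<subseteq> S"
        using \<open>(\<alpha>, i) \<in> S\<close> by blast
      then show "\<exists>I\<in>left_intervals \<alpha>. B \<alpha> i \<inter> fst -` I \<subseteq> \<Union>\<K>"
        using \<open>S \<in> \<K>\<close> by blast
    qed
  qed
  then show ?thesis by (simp add: K_def)
qed

lemma topspace_K:
  assumes "is_family n B"
  shows "topspace (K n B) = UNIV \<times> {..<n}"
proof -
  have "B \<alpha> i \<inter> fst -` I \<subseteq> UNIV \<times> {..<n}" if "i < n" for \<alpha> i I
    using assms that unfolding is_family_def by blast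
  then have "openin (K n B) (UNIV \<times> {..<n})"
    using left_intervals_nonempty by (fastforce simp: openin_K)
  moreover have "topspace (K n B) \<subseteq> UNIV \<times> {..<n}"
    using openin_K[of n B] openin_topspace by blast
  ultimately show ?thesis by (simp add: openin_subset subset_antisym)
qed

lemma openin_K_basic:
  assumes B: "is_family n B" "coherent n B" and "i < n" "I \<in> left_intervals \<alpha>"
  shows "openin (K n B) (B \<alpha> i \<inter> fst -` I)"
  unfolding openin_K
proof (intro conjI)
  have sub: "B \<alpha> i \<subseteq> {..\<alpha>} \<times> {..<n}" using B \<open>i < n\<close> by (auto simp: is_family_def)
  then show "B \<alpha> i \<inter> fst -` I \<subseteq> UNIV \<times> {..<n}" by blast
  show "\<forall>(\<beta>, j)\<in>B \<alpha> i \<inter> fst -` I. \<exists>J\<in>left_intervals \<beta>. B \<beta> j \<inter> fst -` J \<subseteq> B \<alpha> i \<inter> fst -` I"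
  proof clarify
    fix \<beta> j assume mem: "(\<beta>, j) \<in> B \<alpha> i" "fst (\<beta>, j) \<in> I"
    have j: "j < n" and "\<beta> \<le> \<alpha>" using mem sub by auto
    show "\<exists>J\<in>left_intervals \<beta>. B \<beta> j \<inter> fst -` J \<subseteq> B \<alpha> i \<inter> fst -` I"
    proof (cases "\<beta> = \<alpha>")
      case True
      have "j = i"
      proof (rule ccontr)
        assume "j \<noteq> i"
        then have "B \<alpha> j \<inter> B \<alpha> i = {}"
          using B j \<open>i < n\<close> by (auto simp: is_family_def disjoint_family_on_def)
        moreover have "(\<alpha>, j) \<in> B \<alpha> j" using B j by (auto simp: is_family_def)
        ultimately show False using mem True by blast
      qed
      then show ?thesis using True assms by blast
    next
      case False
      then have "\<beta> < \<alpha>" using \<open>\<beta> \<le> \<alpha>\<close> by simp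
      then have "\<exists>J\<in>left_intervals \<beta>. \<forall>i<n. \<forall>j<n.
          (\<beta>, j) \<in> B \<alpha> i \<longrightarrow> B \<alpha> i \<inter> fst -` J = B \<beta> j \<inter> fst -` J"
        using B(2) unfolding coherent_def by simp
      then obtain J where J: "J \<in> left_intervals \<beta>" "B \<alpha> i \<inter> fst -` J = B \<beta> j \<inter> fst -` J"
        using j \<open>i < n\<close> mem(1) by auto
      have "\<exists>J'\<in>left_intervals \<beta>. J' \<subseteq> I"
      proof (cases "\<beta> = 0")
        case True
        then show ?thesis using mem by (auto simp: left_intervals_def)
      next
        case False
        moreover have "\<alpha> \<noteq> 0"
          using \<open>\<beta> < \<alpha>\<close> zero_le_omega1[of \<beta>] leD by blast
        ultimately obtain c where "I = {c<..\<alpha>}"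
          using assms by (auto simp: left_intervals_def)
        then have "{c<..\<beta>} \<in> left_intervals \<beta>" "{c<..\<beta>} \<subseteq> I"
          using mem False \<open>\<beta> < \<alpha>\<close> by (auto simp: left_intervals_def)
        then show ?thesis by blast
      qed
      then obtain J' where "J' \<in> left_intervals \<beta>" "J' \<subseteq> I" by blast
      with J show ?thesis
        by (intro bexI[of _ "J \<inter> J'"] left_intervals_Int) auto
    qed
  qed
qed

end

theory Submission
  imports Defs
begin

text \<open>
  Let \<open>f \<alpha>\<close> be the number of points of \<open>E\<close> over \<open>\<alpha>\<close>. If \<open>\<langle>\<alpha>, i\<rangle> \<notin> E\<close>, then \<open>E\<close>, being closed, misses
  the part of \<open>B \<alpha> i\<close> that lies over some \<open>(\<gamma>, \<alpha>]\<close>. So for all \<open>\<xi> \<le> \<alpha>\<close> close to \<open>\<alpha>\<close>, the points of \<open>E\<close>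
  over \<open>\<xi>\<close> lie in sets \<open>B \<alpha> i\<close> with \<open>\<langle>\<alpha>, i\<rangle> \<in> E\<close>, and by transversality each of these contributes at
  most one. Hence \<open>f \<xi> \<le> f \<alpha>\<close> near \<open>\<alpha>\<close>: the function \<open>f\<close> is upper semicontinuous, that is, all sets
  \<open>{\<alpha>. k \<le> f \<alpha>}\<close> are closed (lemma \<open>closed_card_fibre_ge\<close>).

  An upper semicontinuous function \<open>f\<close> into \<open>{0..n}\<close> is constant on a club
  (lemma \<open>upper_semicontinuous_constant_on_club\<close>): for the largest \<open>m\<close> such that \<open>f \<ge> m\<close>
  unboundedly often, the set where \<open>f \<ge> m\<close> is club, and \<open>f > m\<close> fails beyond some ordinal.
\<close>

lemma omega1_gt_ex: "\<exists>b. (a :: omega1) < b"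
proof (rule ccontr)
  assume "\<not> ?thesis"
  then have "{..a} = UNIV" by (auto simp: not_less)
  then show False using omega1_uncountable omega1_countable_atMost[of a] by simp
qed

text \<open>
  The half-open intervals \<open>(\<gamma>, \<alpha>]\<close> are neighbourhoods of \<open>\<alpha>\<close> because \<open>\<alpha>\<close> has an immediate successor.
\<close>

lemma open_atMost_omega1: "open {..a :: omega1}"
proof -
  define b where "b = (LEAST b. a < b)"
  have "a < b" unfolding b_def using omega1_gt_ex by (rule LeastI_ex)
  moreover have "x \<le> a" if "x < b" for x
    using not_less_Least[of x "\<lambda>b. a < b"] that by (simp add: b_def)
  ultimately have "{..a} = {..<b}" by force
  then show ?thesis by simp
qed

lemma left_intervals_open:
  assumes "I \<in> left_intervals \<alpha>"
  shows "open I"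
proof (cases "\<alpha> = 0")
  case True
  have "{..0 :: omega1} = {0}" by (auto intro: antisym)
  then show ?thesis
    using assms True open_atMost_omega1[of 0] by (simp add: left_intervals_def)
next
  case False
  then obtain c where "I = {c<..} \<inter> {..\<alpha>}"
    using assms by (auto simp: left_intervals_def greaterThanAtMost_def)
  then show ?thesis by (simp add: open_Int open_atMost_omega1)
qed

lemma left_intervals_mem: "I \<in> left_intervals \<alpha> \<Longrightarrow> \<alpha> \<in> I"
  by (auto simp: left_intervals_def split: if_splits)

lemma upper_semicontinuous_constant_on_club:
  fixes f :: "omega1 \<Rightarrow> nat"
  assumes usc: "\<And>k. closed {\<alpha>. k \<le> f \<alpha>}" and le: "\<And>\<alpha>. f \<alpha> \<le> n"
  shows "\<exists>m\<le>n. \<exists>C. club_omega1 C \<and> (\<forall>\<alpha>\<in>C. f \<alpha> = m)"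
proof -
  define P where "P k \<longleftrightarrow> \<not> bdd_above {\<alpha>. k \<le> f \<alpha>}" for k
  have "\<not> bdd_above (UNIV :: omega1 set)"
    using omega1_gt_ex by (auto simp: bdd_above_def not_le)
  then have P0: "P 0" by (simp add: P_def)
  have P_le: "k \<le> n" if "P k" for k
  proof (rule ccontr)
    assume "\<not> k \<le> n"
    then have "{\<alpha>. k \<le> f \<alpha>} = {}" using le by (auto intro: order_trans)
    then show False using that by (simp add: P_def)
  qed
  define m where "m = Greatest P"
  have "P m" unfolding m_def using P0 P_le by (rule GreatestI_nat)
  moreover have "\<not> P (Suc m)"
    using Greatest_le_nat[of P "Suc m" n] P_le by (auto simp: m_def)
  ultimately have m: "P m" "m \<le> n" "\<not> P (Suc m)" using P_le by blast+
  obtain d where d: "\<And>\<alpha>. Suc m \<le> f \<alpha> \<Longrightarrow> \<alpha> \<le> d"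
    using m(3) by (auto simp: P_def bdd_above_def)
  \<comment> \<open>\<open>f\<close> may exceed \<open>m\<close> at \<open>d\<close> itself, so the closed ray must start beyond \<open>d\<close>.\<close>
  obtain b where b: "d < b" using omega1_gt_ex by blast
  let ?C = "{\<alpha>. m \<le> f \<alpha>} \<inter> {b..}"
  have "\<not> bdd_above ?C"
  proof
    assume "bdd_above ?C"
    then obtain c where "\<And>\<alpha>. m \<le> f \<alpha> \<Longrightarrow> b \<le> \<alpha> \<Longrightarrow> \<alpha> \<le> c" by (auto simp: bdd_above_def)
    then have "\<alpha> \<le> max b c" if "m \<le> f \<alpha>" for \<alpha>
      using that by (meson le_max_iff_disj linear)
    then show False using m(1) by (auto simp: P_def bdd_above_def)
  qed
  then have "club_omega1 ?C"
    using usc by (simp add: club_omega1_def closed_Int)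
  moreover have "f \<alpha> = m" if "\<alpha> \<in> ?C" for \<alpha>
  proof (rule antisym)
    have "\<not> \<alpha> \<le> d" using that b by auto
    then show "f \<alpha> \<le> m" using d[of \<alpha>] by (meson not_less_eq_eq)
    show "m \<le> f \<alpha>" using that by simp
  qed
  ultimately show ?thesis using m(2) by blast
qed

text \<open>
  Near \<open>\<alpha>\<close> the points of a closed set \<open>E\<close> are confined to the branches \<open>B \<alpha> i\<close> with \<open>\<langle>\<alpha>, i\<rangle> \<in> E\<close>;
  there are as many of these as points of \<open>E\<close> over \<open>\<alpha>\<close>, and each has one point over each \<open>\<xi> \<le> \<alpha>\<close>.
\<close>

lemma card_fibre_le_near:
  assumes fam: "is_family n B" and tr: "transverse n B" and E: "closedin (K n B) E"
  shows "\<exists>T. open T \<and> \<alpha> \<in> T \<and>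
    (\<forall>\<xi>\<in>T. card (E \<inter> ({\<xi>} \<times> {..<n})) \<le> card (E \<inter> ({\<alpha>} \<times> {..<n})))"
proof -
  have "openin (K n B) (UNIV \<times> {..<n} - E)"
    using E openin_diff[OF openin_topspace E] by (simp add: topspace_K[OF fam])
  then have nbhd: "\<forall>(\<alpha>, i)\<in>UNIV \<times> {..<n} - E.
      \<exists>I\<in>left_intervals \<alpha>. B \<alpha> i \<inter> fst -` I \<subseteq> UNIV \<times> {..<n} - E"
    unfolding openin_K by (rule conjunct2)
  have "\<exists>I\<in>left_intervals \<alpha>. B \<alpha> i \<inter> fst -` I \<inter> E = {}" if "i < n" "(\<alpha>, i) \<notin> E" for i
    using bspec[OF nbhd, of "(\<alpha>, i)"] that by auto
  then obtain I where I: "\<And>i. i < n \<Longrightarrow> (\<alpha>, i) \<notin> E \<Longrightarrow>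
      I i \<in> left_intervals \<alpha> \<and> B \<alpha> i \<inter> fst -` I i \<inter> E = {}"
    by metis
  let ?N = "{i. i < n \<and> (\<alpha>, i) \<notin> E}" and ?M = "{i. i < n \<and> (\<alpha>, i) \<in> E}"
  \<comment> \<open>The factor \<open>{..\<alpha>}\<close> matters when \<open>E\<close> contains the whole fibre over \<open>\<alpha>\<close>.\<close>
  define T where "T = {..\<alpha>} \<inter> (\<Inter>i\<in>?N. I i)"
  have "open (I i)" if "i \<in> ?N" for i
    using I[of i] that left_intervals_open by blast
  then have "open T"
    unfolding T_def by (intro open_Int open_INT open_atMost_omega1) auto
  moreover have "\<alpha> \<in> T" using I left_intervals_mem by (auto simp: T_def)
  moreover have "card (E \<inter> ({\<xi>} \<times> {..<n})) \<le> card (E \<inter> ({\<alpha>} \<times> {..<n}))" if "\<xi> \<in> T" for \<xi>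
  proof -
    have \<xi>: "\<xi> \<le> \<alpha>" using that by (simp add: T_def)
    have one: "card (B \<alpha> i \<inter> fst -` {\<xi>}) = 1" if "i < n" for i
      using tr \<xi> that by (simp add: transverse_def is_singleton_altdef)
    have sub: "E \<inter> ({\<xi>} \<times> {..<n}) \<subseteq> (\<Union>i\<in>?M. B \<alpha> i \<inter> fst -` {\<xi>})"
    proof clarify
      fix j assume j: "(\<xi>, j) \<in> E" "j < n"
      then have "(\<xi>, j) \<in> (\<Union>i<n. B \<alpha> i)" using fam \<xi> by (auto simp: is_family_def)
      then obtain i where i: "i < n" "(\<xi>, j) \<in> B \<alpha> i" by blast
      have "(\<alpha>, i) \<in> E"
      proof (rule ccontr)
        assume "(\<alpha>, i) \<notin> E"
        then have "B \<alpha> i \<inter> fst -` I i \<inter> E = {}" "\<xi> \<in> I i"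
          using I i(1) that by (auto simp: T_def)
        then show False using i j by auto
      qed
      then show "(\<xi>, j) \<in> (\<Union>i\<in>?M. B \<alpha> i \<inter> fst -` {\<xi>})"
        using i by (intro UN_I[of i]) auto
    qed
    have "finite (B \<alpha> i \<inter> fst -` {\<xi>})" if "i \<in> ?M" for i
      using one[of i] that by (intro card_ge_0_finite) simp
    then have "finite (\<Union>i\<in>?M. B \<alpha> i \<inter> fst -` {\<xi>})" by (intro finite_UN_I) simp_all
    then have "card (E \<inter> ({\<xi>} \<times> {..<n})) \<le> card (\<Union>i\<in>?M. B \<alpha> i \<inter> fst -` {\<xi>})"
      using sub by (rule card_mono)
    also have "\<dots> \<le> (\<Sum>i\<in>?M. card (B \<alpha> i \<inter> fst -` {\<xi>}))"
      by (rule card_UN_le) simp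
    also have "\<dots> = card ?M" using one by simp
    also have "\<dots> = card (Pair \<alpha> ` ?M)" by (simp add: card_image inj_on_def)
    also have "Pair \<alpha> ` ?M = E \<inter> ({\<alpha>} \<times> {..<n})" by auto
    finally show ?thesis .
  qed
  ultimately show ?thesis by blast
qed

lemma closed_card_fibre_ge:
  assumes "is_family n B" "transverse n B" "closedin (K n B) E"
  shows "closed {\<alpha>. k \<le> card (E \<inter> ({\<alpha>} \<times> {..<n}))}"
proof -
  have "open {\<alpha>. card (E \<inter> ({\<alpha>} \<times> {..<n})) < k}"
  proof (subst open_subopen, intro ballI)
    fix \<alpha> assume "\<alpha> \<in> {\<alpha>. card (E \<inter> ({\<alpha>} \<times> {..<n})) < k}"
    then show "\<exists>T. open T \<and> \<alpha> \<in> T \<and> T \<subseteq> {\<alpha>. card (E \<inter> ({\<alpha>} \<times> {..<n})) < k}"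
      using card_fibre_le_near[OF assms, of \<alpha>] by (blast intro: le_less_trans)
  qed
  moreover have "- {\<alpha>. k \<le> card (E \<inter> ({\<alpha>} \<times> {..<n}))} = {\<alpha>. card (E \<inter> ({\<alpha>} \<times> {..<n})) < k}"
    by auto
  ultimately show ?thesis by (simp add: closed_def)
qed

theorem lemma6p10:
  fixes n :: nat and B :: "omega1 \<Rightarrow> nat \<Rightarrow> (omega1 \<times> nat) set" and E :: "(omega1 \<times> nat) set"
  assumes "n \<ge> 1"
    and "is_family n B"
    and "transverse n B"
    and "coherent n B"
    and "club_K n B E"
  shows "\<exists>m\<le>n. \<exists>C. club_omega1 C \<and> (\<forall>\<alpha>\<in>C. card (E \<inter> ({\<alpha>} \<times> {..<n})) = m)"
proof (rule upper_semicontinuous_constant_on_club)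
  show "closed {\<alpha>. k \<le> card (E \<inter> ({\<alpha>} \<times> {..<n}))}" for k
    using assms by (intro closed_card_fibre_ge) (auto simp: club_K_def)
  show "card (E \<inter> ({\<alpha>} \<times> {..<n})) \<le> n" for \<alpha>
    using card_mono[of "{\<alpha>} \<times> {..<n}" "E \<inter> ({\<alpha>} \<times> {..<n})"] by simp
qed

end
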